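(* Let $d\ge1$, let $T$ be a continuous $T$-norm, and let $P$ be a collection of $n$ points in $[0,1]^d$. Then there exists a point $p\in[0,1]^d$ such that every max-T convex set containing more than $dn/(d+1)$ points of $P$ also contains $p$.
   Context: A $T$-norm is a function $T:[0,1]^2\to[0,1]$ such that for all $x,y,z\in[0,1]$: $T(x,T(y,z))=T(T(x,y),z)$; $T(x,y)\le T(x,z)$ and $T(y,x)\le T(z,x)$ whenever $y\le z$; $T(x,1)=T(1,x)=x$. It is continuous if $\lim_n T(x_n,y_n)=T(\lim_n x_n,\lim_n y_n)$ for all convergent sequences $(x_n),(y_n)$ in $[0,1]$. Put $a\oplus b=\max(a,b)$ and $a\otimes_T b=T(a,b)$; $\oplus$ acts on vectors of $[0,1]^d$ componentwise and $(\lambda\otimes_T x)_k=T(\lambda,x_k)$. A set $C\subseteq[0,1]^d$ is max-T convex if for all $x,y\in C$ and $\lambda,\mu\in[0,1]$ with $\lambda\oplus\mu=1$ one has $\lambda\otimes_T x\oplus\mu\otimes_T y\in C$. *)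

theory Defs
  imports "HOL-Analysis.Analysis" "HOL-Library.Multiset"
begin

(* Only the values of T on the unit square matter. Commutativity is deliberately not required. *)
definition t_norm :: "(real \<Rightarrow> real \<Rightarrow> real) \<Rightarrow> bool" where
  "t_norm T \<longleftrightarrow>
     (\<forall>x\<in>{0..1}. \<forall>y\<in>{0..1}. T x y \<in> {0..1}) \<and>
     (\<forall>x\<in>{0..1}. \<forall>y\<in>{0..1}. \<forall>z\<in>{0..1}. T x (T y z) = T (T x y) z) \<and>
     (\<forall>x\<in>{0..1}. \<forall>y\<in>{0..1}. \<forall>z\<in>{0..1}. y \<le> z \<longrightarrow> T x y \<le> T x z \<and> T y x \<le> T z x) \<and>
     (\<forall>x\<in>{0..1}. T x 1 = x \<and> T 1 x = x)"

definition continuous_t_norm :: "(real \<Rightarrow> real \<Rightarrow> real) \<Rightarrow> bool" where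
  "continuous_t_norm T \<longleftrightarrow>
     t_norm T \<and>
     (\<forall>X Y x y. (\<forall>n. X n \<in> {0..1}) \<longrightarrow> (\<forall>n. Y n \<in> {0..1}) \<longrightarrow>
        X \<longlonglongrightarrow> x \<longrightarrow> Y \<longlonglongrightarrow> y \<longrightarrow> (\<lambda>n. T (X n) (Y n)) \<longlonglongrightarrow> T x y)"

lemma continuous_t_norm_iff_continuous_on:
  "continuous_t_norm T \<longleftrightarrow>
     t_norm T \<and> continuous_on ({0..1} \<times> {0..1}) (\<lambda>(x, y). T x y)"
proof -
  have "(\<forall>X Y x y. (\<forall>n. X n \<in> {0..1}) \<longrightarrow> (\<forall>n. Y n \<in> {0..1}) \<longrightarrow>
          X \<longlonglongrightarrow> x \<longrightarrow> Y \<longlonglongrightarrow> y \<longrightarrow> (\<lambda>n. T (X n) (Y n)) \<longlonglongrightarrow> T x y) \<longleftrightarrow>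
        continuous_on ({0..1} \<times> {0..1}) (\<lambda>(x, y). T x y)" (is "?S \<longleftrightarrow> ?C")
  proof
    assume S: ?S
    show ?C
      unfolding continuous_on_sequentially
    proof (intro allI ballI impI)
      fix Z :: "nat \<Rightarrow> real \<times> real" and a
      assume Z: "(\<forall>n. Z n \<in> {0..1} \<times> {0..1}) \<and> Z \<longlonglongrightarrow> a"
      have "\<forall>n. (fst \<circ> Z) n \<in> {0..1}" "\<forall>n. (snd \<circ> Z) n \<in> {0..1}"
        using Z by (auto simp: mem_Times_iff)
      moreover have "(fst \<circ> Z) \<longlonglongrightarrow> fst a" "(snd \<circ> Z) \<longlonglongrightarrow> snd a"
        using Z tendsto_fst[of Z a sequentially] tendsto_snd[of Z a sequentially]
        by (auto simp: o_def)
      ultimately have "(\<lambda>n. T ((fst \<circ> Z) n) ((snd \<circ> Z) n)) \<longlonglongrightarrow> T (fst a) (snd a)"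
        using S by blast
      then show "((\<lambda>(x, y). T x y) \<circ> Z) \<longlonglongrightarrow> (\<lambda>(x, y). T x y) a"
        by (simp add: o_def case_prod_beta)
    qed
  next
    assume C: ?C
    show ?S
    proof (intro allI impI)
      fix X Y :: "nat \<Rightarrow> real" and x y
      assume XY: "\<forall>n. X n \<in> {0..1}" "\<forall>n. Y n \<in> {0..1}" "X \<longlonglongrightarrow> x" "Y \<longlonglongrightarrow> y"
      have "x \<in> {0..1}" "y \<in> {0..1}"
        by (rule closed_sequentially[OF closed_atLeastAtMost XY(1)[rule_format] XY(3)])
          (rule closed_sequentially[OF closed_atLeastAtMost XY(2)[rule_format] XY(4)])
      moreover have "(\<lambda>n. (X n, Y n)) \<longlonglongrightarrow> (x, y)"
        using XY by (intro tendsto_Pair)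
      ultimately have "(\<lambda>n. (\<lambda>(x, y). T x y) (X n, Y n)) \<longlonglongrightarrow> (\<lambda>(x, y). T x y) (x, y)"
        using XY(1,2)
        by (intro continuous_on_tendsto_compose[OF C]) (simp_all only: mem_Sigma_iff simp_thms eventually_True)
      then show "(\<lambda>n. T (X n) (Y n)) \<longlonglongrightarrow> T x y"
        by simp
    qed
  qed
  then show ?thesis
    unfolding continuous_t_norm_def by (rule conj_cong[OF refl])
qed

definition unit_cube :: "(real ^ 'd) set" where
  "unit_cube = {x. \<forall>k. x $ k \<in> {0..1}}"

definition vmax :: "real ^ 'd \<Rightarrow> real ^ 'd \<Rightarrow> real ^ 'd" where
  "vmax x y = (\<chi> k. max (x $ k) (y $ k))"

definition t_scale :: "(real \<Rightarrow> real \<Rightarrow> real) \<Rightarrow> real \<Rightarrow> real ^ 'd \<Rightarrow> real ^ 'd" where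
  "t_scale T l x = (\<chi> k. T l (x $ k))"

definition max_T_convex :: "(real \<Rightarrow> real \<Rightarrow> real) \<Rightarrow> (real ^ 'd) set \<Rightarrow> bool" where
  "max_T_convex T C \<longleftrightarrow>
     C \<subseteq> unit_cube \<and>
     (\<forall>x\<in>C. \<forall>y\<in>C. \<forall>l\<in>{0..1}. \<forall>m\<in>{0..1}. max l m = 1 \<longrightarrow>
        vmax (t_scale T l x) (t_scale T m y) \<in> C)"

end

theory Submission
  imports Defs
begin

text \<open>
  By the usual counting argument it suffices to show that max-T convexity has Helly number at most
  \<open>d + 1\<close>, and by induction on the size of the family the Helly property reduces to \<open>d + 2\<close> points
  \<open>x\<^sub>i\<close>: the images \<open>K\<^sub>j\<close> of the facets of the simplex under the parametrization \<open>h\<close> of the max-T hull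
  of these points have a common point. Let \<open>D\<^sub>j\<close> be the distance to \<open>K\<^sub>j\<close>. The cone over the image of
  \<open>D\<close> is a locally Lipschitz image of a \<open>(d + 1)\<close>-dimensional space in \<open>(d + 2)\<close>-dimensional space,
  so it is negligible and misses some positive vector \<open>q\<close>. If the \<open>K\<^sub>j\<close> had no common point, then the
  numbers \<open>w\<^sub>j = D\<^sub>j (h y) / q\<^sub>j\<close> would never be all equal, and Brouwer's theorem for the self-map of
  the simplex with weights proportional to \<open>\<Sum>\<^sub>i max 0 (w\<^sub>i - w\<^sub>j)\<close> would yield a contradiction,
  because \<open>D\<^sub>j \<circ> h\<close> vanishes on the \<open>j\<close>-th facet.
\<close>

section \<open>Two topological lemmas\<close>

lemma negligible_cone_lipschitz:
  fixes D :: "'a::euclidean_space \<Rightarrow> 'b::euclidean_space"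
  assumes dim: "DIM('a) + 2 \<le> DIM('b)"
    and lip: "\<And>x y. norm (D x - D y) \<le> L * norm (x - y)"
  shows "negligible {t *\<^sub>R D z |t z. True}"
proof -
  \<comment> \<open>The dummy coordinate \<open>s\<close>, fixed to 0 on \<open>S\<close>, turns the
    parameters of the cone into a hyperplane in dimension \<open>DIM('a) + 2\<close>, and
    negligibility passes to the image.\<close>
  define S :: "(real \<times> real \<times> 'a) set" where "S = {p. (1, 0) \<bullet> p = 0}"
  define f :: "real \<times> real \<times> 'a \<Rightarrow> 'b" where "f = (\<lambda>(s, t, z). t *\<^sub>R D z)"
  have L: "L \<ge> 0"
  proof -
    obtain b :: 'a where b: "norm b = 1"
      using vector_choose_size[of 1] by auto
    have "0 \<le> norm (D b - D 0)" by simp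
    also have "\<dots> \<le> L" using lip[of b 0] b by simp
    finally show ?thesis .
  qed
  have "negligible (f ` S)"
  proof (rule negligible_locally_Lipschitz_image)
    show "DIM(real \<times> real \<times> 'a) \<le> DIM('b)" using dim by simp
    show "negligible S"
      unfolding S_def by (rule negligible_hyperplane) (simp add: zero_prod_def)
    fix x assume "x \<in> S"
    obtain s t z where x: "x = (s, t, z)" by (cases x)
    show "\<exists>U B. open U \<and> x \<in> U \<and> (\<forall>y\<in>S \<inter> U. norm (f y - f x) \<le> B * norm (y - x))"
    proof (intro exI conjI ballI)
      show "open (ball x 1)" "x \<in> ball x 1" by simp_all
      fix y assume y: "y \<in> S \<inter> ball x 1"
      obtain s' t' z' where y': "y = (s', t', z')" by (cases y)
      have n: "\<bar>t' - t\<bar> \<le> norm (y - x)" "norm (z' - z) \<le> norm (y - x)"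
        using norm_snd_le[of "(t' - t, z' - z)" "s' - s"] norm_fst_le[of "t' - t" "z' - z"]
          norm_snd_le[of "z' - z" "t' - t"]
        by (auto simp: x y')
      have "norm (y - x) < 1" using y by (simp add: dist_norm norm_minus_commute)
      with n have t': "\<bar>t'\<bar> \<le> \<bar>t\<bar> + 1" by linarith
      have "f y - f x = t' *\<^sub>R (D z' - D z) + (t' - t) *\<^sub>R D z"
        by (simp add: f_def x y' algebra_simps)
      then have "norm (f y - f x) \<le> \<bar>t'\<bar> * norm (D z' - D z) + \<bar>t' - t\<bar> * norm (D z)"
        by (metis norm_scaleR norm_triangle_ineq)
      also have "\<dots> \<le> (\<bar>t\<bar> + 1) * (L * norm (y - x)) + norm (y - x) * norm (D z)"
        using t' n L lip[of z' z]
        by (intro add_mono mult_mono order_trans[OF lip[of z' z]] mult_left_mono) auto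
      finally show "norm (f y - f x) \<le> ((\<bar>t\<bar> + 1) * L + norm (D z)) * norm (y - x)"
        by (simp add: algebra_simps)
    qed
  qed
  moreover have "{t *\<^sub>R D z |t z. True} \<subseteq> f ` S"
  proof clarify
    fix t z
    show "t *\<^sub>R D z \<in> f ` S"
      by (rule image_eqI[of _ _ "(0, t, z)"]) (auto simp: f_def S_def)
  qed
  ultimately show ?thesis by (rule negligible_subset)
qed

definition std_simplex :: "(real ^ 'i) set" where
  "std_simplex = {y. (\<forall>i. 0 \<le> y $ i) \<and> (\<Sum>i\<in>UNIV. y $ i) = 1}"

lemma std_simplex_nonempty: "std_simplex \<noteq> ({} :: (real ^ 'i) set)"
proof -
  have "axis k 1 \<in> (std_simplex :: (real ^ 'i) set)" for k
    by (auto simp: std_simplex_def axis_def)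
  then show ?thesis by blast
qed

lemma convex_std_simplex: "convex std_simplex"
  by (rule convexI) (auto simp: std_simplex_def sum.distrib simp flip: sum_distrib_left)

lemma compact_std_simplex: "compact (std_simplex :: (real ^ 'i) set)"
proof (rule compact_eq_bounded_closed[THEN iffD2], intro conjI)
  have "std_simplex \<subseteq> cball (0 :: real ^ 'i) 1"
  proof
    fix y :: "real ^ 'i" assume "y \<in> std_simplex"
    then have "(\<Sum>i\<in>UNIV. \<bar>y $ i\<bar>) = 1" by (simp add: std_simplex_def)
    with norm_le_l1_cart[of y] show "y \<in> cball 0 1" by simp
  qed
  then show "bounded (std_simplex :: (real ^ 'i) set)"
    by (rule bounded_subset[OF bounded_cball])
  have "std_simplex = (\<Inter>i. {y :: real ^ 'i. 0 \<le> y $ i}) \<inter> {y. (\<Sum>i\<in>UNIV. y $ i) = 1}"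
    by (auto simp: std_simplex_def)
  also have "closed \<dots>"
    by (intro closed_Int closed_INT ballI closed_Collect_le closed_Collect_eq continuous_intros)
  finally show "closed (std_simplex :: (real ^ 'i) set)" .
qed

text \<open>The topological core of Helly's theorem: \<open>h\<close> will parametrize a max-T hull,
  and its continuity alone makes the facet images meet.\<close>

lemma facet_images_common_point:
  fixes h :: "real ^ 'i \<Rightarrow> 'a::euclidean_space"
  assumes card: "DIM('a) + 2 \<le> CARD('i)"
    and h: "continuous_on std_simplex h"
  shows "\<exists>z. \<forall>j. z \<in> h ` {y \<in> std_simplex. y $ j = 0}"
proof -
  define K where "K j = h ` {y \<in> std_simplex. y $ j = 0}" for j
  define D :: "'a \<Rightarrow> real ^ 'i" where "D z = (\<chi> j. infdist z (K j))" for z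
  have K: "closed (K j)" for j
  proof -
    have "{y :: real ^ 'i. y \<in> std_simplex \<and> y $ j = 0} = std_simplex \<inter> {y. y $ j = 0}" by auto
    moreover have "compact \<dots>"
      by (intro compact_Int_closed compact_std_simplex closed_Collect_eq continuous_intros)
    ultimately show ?thesis
      unfolding K_def
      by (intro compact_imp_closed compact_continuous_image continuous_on_subset[OF h]) auto
  qed
  \<comment> \<open>\<open>infdist\<close> to the empty set is 0 by convention, so zero distance
    means membership only for a nonempty closed set.\<close>
  have K_ne: "K j \<noteq> {}" for j
  proof -
    have "CARD('i) \<ge> 2" using card by simp
    then obtain k where "k \<noteq> j"
      by (metis UNIV_I card_2_iff' ex_card subset_UNIV)
    then have "axis k 1 \<in> {y \<in> std_simplex :: (real ^ 'i) set. y $ j = 0}"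
      by (auto simp: std_simplex_def axis_def)
    then show ?thesis unfolding K_def by blast
  qed
  have "norm (D x - D y) \<le> real CARD('i) * norm (x - y)" for x y
  proof -
    have "norm (D x - D y) \<le> (\<Sum>j\<in>UNIV. \<bar>infdist x (K j) - infdist y (K j)\<bar>)"
      using norm_le_l1_cart[of "D x - D y"] by (simp add: D_def)
    also have "\<dots> \<le> (\<Sum>j\<in>(UNIV :: 'i set). norm (x - y))"
      by (intro sum_mono) (metis infdist_triangle_abs dist_norm)
    finally show ?thesis by simp
  qed
  moreover have "DIM('a) + 2 \<le> DIM(real ^ 'i)" using card by simp
  ultimately have cone: "negligible {t *\<^sub>R D z |t z. True}"
    using negligible_cone_lipschitz by blast
  \<comment> \<open>The open positive orthant is not negligible, so the cone cannot cover
    it.\<close>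
  have "open {q :: real ^ 'i. \<forall>i. 0 < q $ i}"
    unfolding Collect_all_eq by (intro open_INT finite ballI open_Collect_less continuous_intros)
  moreover have "(\<chi> i. 1) \<in> {q :: real ^ 'i. \<forall>i. 0 < q $ i}" by simp
  ultimately have "\<not> negligible {q :: real ^ 'i. \<forall>i. 0 < q $ i}"
    by (intro open_not_negligible) blast+
  with cone have "\<not> {q :: real ^ 'i. \<forall>i. 0 < q $ i} \<subseteq> {t *\<^sub>R D z |t z. True}"
    using negligible_subset by blast
  then obtain q :: "real ^ 'i" where q: "\<And>i. 0 < q $ i" "\<And>t z. q \<noteq> t *\<^sub>R D z"
    by blast
  \<comment> \<open>The values \<open>w y j\<close> agree for all \<open>j\<close> exactly when
    \<open>D (h y)\<close> is a multiple of \<open>q\<close>; the choice of \<open>q\<close> leaves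
    only the multiple 0, that is, a common point.\<close>
  define w where "w y j = infdist (h y) (K j) / q $ j" for y j
  \<comment> \<open>The total excess of the other values over \<open>w y j\<close>; it vanishes
    exactly at the maximizing indices.\<close>
  define u where "u y j = (\<Sum>i\<in>UNIV. max 0 (w y i - w y j))" for y j
  have u_nonneg: "0 \<le> u y j" for y j
    unfolding u_def by (intro sum_nonneg) simp
  have w_facet: "w y j = 0" if "y \<in> std_simplex" "y $ j = 0" for y j
    using that by (auto simp: w_def K_def)
  have u_zero: "u y j = 0 \<longleftrightarrow> (\<forall>i. w y i \<le> w y j)" for y j
    unfolding u_def by (subst sum_nonneg_eq_0_iff) (simp_all flip: max.absorb_iff1)
  obtain y where "h y \<in> K j" for j
  proof (rule ccontr)
    assume neg: "\<not> thesis"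
    have u_pos: "0 < (\<Sum>j\<in>UNIV. u y j)" for y
    proof (rule ccontr)
      assume "\<not> 0 < (\<Sum>j\<in>UNIV. u y j)"
      then have "(\<Sum>j\<in>UNIV. u y j) = 0"
        using sum_nonneg[of UNIV "u y"] u_nonneg by force
      then have "\<forall>j. u y j = 0"
        by (subst (asm) sum_nonneg_eq_0_iff) (auto simp: u_nonneg)
      then have const: "w y i = w y j" for i j
        by (meson u_zero order.antisym)
      then obtain c where c: "\<And>j. w y j = c" by metis
      have D: "D (h y) = c *\<^sub>R q"
      proof -
        have "infdist (h y) (K j) = c * q $ j" for j
          using c[of j] q(1)[of j] by (simp add: w_def field_simps)
        then show ?thesis by (simp add: D_def vec_eq_iff)
      qed
      show False
      proof (cases "c = 0")
        case True
        then have "h y \<in> K j" for j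
          using D K K_ne by (simp add: D_def vec_eq_iff in_closed_iff_infdist_zero)
        then show False using neg that by blast
      next
        case False
        then have "q = inverse c *\<^sub>R D (h y)" using D by simp
        then show False using q(2) by blast
      qed
    qed
    define F where "F y = (\<chi> j. u y j / (\<Sum>i\<in>UNIV. u y i))" for y
    have "continuous_on std_simplex (\<lambda>y. u y j)" for j
      unfolding u_def w_def using q(1) by (intro continuous_intros h) (metis less_irrefl)+
    moreover have "(\<Sum>i\<in>UNIV. u y i) \<noteq> 0" for y using u_pos[of y] by simp
    ultimately have "continuous_on std_simplex F"
      unfolding F_def by (intro continuous_intros) auto
    moreover have "F \<in> std_simplex \<rightarrow> std_simplex"
    proof
      fix y
      show "F y \<in> std_simplex"
        using u_pos[of y] u_nonneg
        by (auto simp: std_simplex_def F_def sum_divide_distrib[symmetric] intro!: divide_nonneg_pos)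
    qed
    ultimately obtain y where y: "y \<in> std_simplex" "F y = y"
      using brouwer compact_std_simplex convex_std_simplex std_simplex_nonempty by metis
    \<comment> \<open>A maximizing index \<open>j\<close> has weight 0 in \<open>F y = y\<close>, so
      \<open>y\<close> lies on the \<open>j\<close>-th facet and the maximum is 0. All values are
      then 0, against \<open>u_pos\<close>.\<close>
    have "finite (range (w y))" "range (w y) \<noteq> {}" by auto
    then obtain j where j: "w y j = Max (range (w y))"
      using Max_in by (metis (no_types, lifting) imageE)
    then have le: "w y i \<le> w y j" for i by (simp add: Max_ge)
    then have "u y j = 0" by (simp add: u_zero)
    then have "F y $ j = 0" by (simp add: F_def)
    then have "w y j = 0" using w_facet y by metis
    moreover have "0 \<le> w y i" for i
      using q(1)[of i] by (simp add: w_def infdist_nonneg)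
    ultimately have "w y i = 0" for i using le[of i] by (metis order.antisym)
    then have "u y i = 0" for i by (simp add: u_def)
    then show False using u_pos[of y] by simp
  qed
  then show ?thesis unfolding K_def by blast
qed

section \<open>Max-T combinations\<close>

lemma continuous_on_Max:
  fixes f :: "'i \<Rightarrow> 'a::topological_space \<Rightarrow> real"
  assumes "finite A" "A \<noteq> {}" "\<And>i. i \<in> A \<Longrightarrow> continuous_on S (f i)"
  shows "continuous_on S (\<lambda>y. Max ((\<lambda>i. f i y) ` A))"
  using assms
proof (induction A rule: finite_ne_induct)
  case (insert i A)
  then have "continuous_on S (\<lambda>y. max (f i y) (Max ((\<lambda>i. f i y) ` A)))"
    by (intro continuous_on_max) auto
  with insert show ?case by simp
qed simp

definition max_T_comb :: "(real \<Rightarrow> real \<Rightarrow> real) \<Rightarrow> 'i set \<Rightarrow> ('i \<Rightarrow> real) \<Rightarrow> ('i \<Rightarrow> real ^ 'd) \<Rightarrow> real ^ 'd" where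
  "max_T_comb T A l x = (\<chi> k. Max ((\<lambda>i. T (l i) (x i $ k)) ` A))"

lemma t_norm_zero_left:
  assumes "t_norm T" "v \<in> {0..1}"
  shows "T 0 v = 0"
proof -
  have I: "0 \<in> {0..1 :: real}" "1 \<in> {0..1 :: real}" "v \<le> 1" using assms by auto
  have "T 0 v \<le> T 0 1" "T 0 1 = 0" "T 0 v \<in> {0..1}"
    using assms I unfolding t_norm_def by blast+
  then show ?thesis by simp
qed

text \<open>Points are added one at a time, starting from \<open>i0\<close>. The partial combination
  enters with weight 1, and scaling by 1 is the identity on \<open>C\<close>, so the binary
  condition applies each time.\<close>

lemma max_T_convex_comb:
  assumes T: "t_norm T" and C: "max_T_convex T C"
    and "finite A" "i0 \<in> A" "l i0 = 1"
    and "\<And>i. i \<in> A \<Longrightarrow> l i \<in> {0..1}" "\<And>i. i \<in> A \<Longrightarrow> x i \<in> C"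
  shows "max_T_comb T A l x \<in> C"
proof -
  have cube: "v $ k \<in> {0..1}" if "v \<in> C" for v k
    using that C unfolding max_T_convex_def unit_cube_def by blast
  have one: "t_scale T 1 v = v" if "v \<in> C" for v
    using T cube[OF that] unfolding t_norm_def by (simp add: t_scale_def vec_eq_iff)
  have "max_T_comb T (insert i0 B) l x \<in> C" if "finite B" "B \<subseteq> A" for B
    using that
  proof (induction B rule: finite_induct)
    case empty
    have "max_T_comb T {i0} l x = t_scale T 1 (x i0)"
      by (simp add: max_T_comb_def t_scale_def assms)
    then show ?case using one assms by simp
  next
    case (insert j B)
    let ?z = "max_T_comb T (insert i0 B) l x"
    have z: "?z \<in> C" using insert by simp
    have "vmax (t_scale T (l j) (x j)) (t_scale T 1 ?z) \<in> C"
      using C z insert.prems assms unfolding max_T_convex_def by (auto simp: max_def)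
    also have "vmax (t_scale T (l j) (x j)) (t_scale T 1 ?z) = max_T_comb T (insert j (insert i0 B)) l x"
      using insert.hyps unfolding one[OF z]
      by (simp add: max_T_comb_def vmax_def t_scale_def vec_eq_iff)
    finally show ?case by (simp add: insert_commute)
  qed
  from this[of A] assms show ?thesis by (simp add: insert_absorb)
qed

text \<open>Weight 0 yields the entry 0, which is absorbed by the nonnegative entry at
  \<open>i0\<close>; this index also keeps the remaining \<open>Max\<close> over a nonempty
  set.\<close>

lemma max_T_comb_remove:
  fixes x :: "'i::finite \<Rightarrow> real ^ 'd"
  assumes T: "t_norm T" and l: "\<And>i. l i \<in> {0..1}" "l j = 0" and "i0 \<noteq> j"
    and x: "\<And>i. x i \<in> unit_cube"
  shows "max_T_comb T UNIV l x = max_T_comb T (UNIV - {j}) l x"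
proof -
  have "Max (range (\<lambda>i. T (l i) (x i $ k))) = Max ((\<lambda>i. T (l i) (x i $ k)) ` (UNIV - {j}))" for k
  proof -
    let ?f = "\<lambda>i. T (l i) (x i $ k)"
    have v: "x i $ k \<in> {0..1}" for i using x unfolding unit_cube_def by blast
    have "range ?f = insert (?f j) (?f ` (UNIV - {j}))" by blast
    then have "Max (range ?f) = max (?f j) (Max (?f ` (UNIV - {j})))"
      using \<open>i0 \<noteq> j\<close> by (simp add: Max_insert) (subst Max_insert; auto)
    moreover have "?f j = 0" using t_norm_zero_left[OF T v] l by simp
    moreover have "0 \<le> ?f i0" using T l v unfolding t_norm_def by auto
    moreover have "?f i0 \<le> Max (?f ` (UNIV - {j}))" using \<open>i0 \<noteq> j\<close> by (intro Max_ge) auto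
    ultimately show ?thesis by simp
  qed
  then show ?thesis by (simp add: max_T_comb_def)
qed

section \<open>Helly's theorem\<close>

text \<open>Pick \<open>x j\<close> in every \<open>A i\<close> with \<open>i \<noteq> j\<close>. On
  the \<open>j\<close>-th facet \<open>x j\<close> has weight 0, so only points of
  \<open>A j\<close> are combined and \<open>h\<close> maps this facet into
  \<open>A j\<close>.\<close>

lemma max_T_helly_indexed:
  fixes A :: "'i::finite \<Rightarrow> (real ^ 'd) set"
  assumes T: "continuous_t_norm T" and card: "CARD('d) + 2 \<le> CARD('i)"
    and A: "\<And>i. max_T_convex T (A i)"
    and ne: "\<And>j. (\<Inter>i\<in>UNIV - {j}. A i) \<noteq> {}"
  shows "(\<Inter>i. A i) \<noteq> {}"
proof -
  have T': "t_norm T" and cont: "continuous_on ({0..1} \<times> {0..1}) (\<lambda>(x, y). T x y)"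
    using T unfolding continuous_t_norm_iff_continuous_on by blast+
  obtain x where x: "\<And>i j. i \<noteq> j \<Longrightarrow> x j \<in> A i"
  proof -
    have "\<forall>j. \<exists>v. \<forall>i\<in>UNIV - {j}. v \<in> A i" using ne by blast
    then show ?thesis using that by (metis DiffI UNIV_I singletonD)
  qed
  have other: "\<exists>i. i \<noteq> j" for j :: 'i
  proof -
    have "CARD('i) \<ge> 2" using card by simp
    then show ?thesis by (metis UNIV_I card_2_iff' ex_card subset_UNIV)
  qed
  have x_cube: "x j \<in> unit_cube" for j
    using other[of j] x A unfolding max_T_convex_def by blast
  define N where "N = real CARD('i)"
  have N: "N > 0" unfolding N_def by simp
  \<comment> \<open>On the simplex some coordinate is at least \<open>1 / N\<close>, so that some weight equals 1.\<close>
  define l :: "real ^ 'i \<Rightarrow> 'i \<Rightarrow> real" where "l y i = min 1 (N * y $ i)" for y i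
  define h where "h y = max_T_comb T UNIV (l y) x" for y
  have l: "l y i \<in> {0..1}" if "y \<in> std_simplex" for y i
    using that N by (auto simp: l_def std_simplex_def)
  have "continuous_on std_simplex (\<lambda>y. T (l y i) (x i $ k))" for i k
  proof -
    have "x i $ k \<in> {0..1}" using x_cube unfolding unit_cube_def by blast
    with l have "(\<lambda>y. (l y i, x i $ k)) ` std_simplex \<subseteq> {0..1} \<times> {0..1}" by blast
    moreover have "continuous_on std_simplex (\<lambda>y. (l y i, x i $ k))"
      unfolding l_def by (intro continuous_intros)
    ultimately have "continuous_on std_simplex (\<lambda>y. (\<lambda>(x, y). T x y) (l y i, x i $ k))"
      by (intro continuous_on_compose2[OF cont]) auto
    then show ?thesis by simp
  qed
  then have "continuous_on std_simplex h"
    unfolding h_def max_T_comb_def by (intro continuous_intros continuous_on_Max) auto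
  then obtain z where z: "\<And>j. z \<in> h ` {y \<in> std_simplex. y $ j = 0}"
    using facet_images_common_point[of h] card by auto
  have "z \<in> A j" for j
  proof -
    obtain y where y: "y \<in> std_simplex" "y $ j = 0" "z = h y" using z[of j] by blast
    have "\<exists>i. 1 \<le> N * y $ i"
    proof (rule ccontr)
      assume "\<not> ?thesis"
      then have "(\<Sum>i\<in>UNIV. N * y $ i) < (\<Sum>i\<in>(UNIV :: 'i set). 1)"
        by (intro sum_strict_mono) (auto simp: not_le)
      then show False
        using y(1) unfolding std_simplex_def by (simp add: N_def flip: sum_distrib_left)
    qed
    then obtain i0 where i0: "l y i0 = 1" unfolding l_def by (metis min.absorb1)
    have lj: "l y j = 0" using y by (simp add: l_def)
    with i0 have "i0 \<noteq> j" by auto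
    then have "h y = max_T_comb T (UNIV - {j}) (l y) x"
      unfolding h_def using l[OF y(1)] lj x_cube by (intro max_T_comb_remove T')
    also have "\<dots> \<in> A j"
      using A i0 \<open>i0 \<noteq> j\<close> x l[OF y(1)] by (intro max_T_convex_comb[OF T', where ?i0.0 = i0]) auto
    finally show ?thesis using y by simp
  qed
  then show ?thesis by blast
qed

text \<open>Nonemptiness matters: \<open>\<Inter>{}\<close> is the whole space, which does not lie
  in the cube.\<close>

lemma max_T_convex_Inter:
  assumes "\<F> \<noteq> {}" "\<And>C. C \<in> \<F> \<Longrightarrow> max_T_convex T C"
  shows "max_T_convex T (\<Inter>\<F>)"
  using assms unfolding max_T_convex_def by (auto; blast)

theorem max_T_helly:
  fixes \<F> :: "(real ^ 'd) set set"
  assumes T: "continuous_t_norm T" and "finite \<F>"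
    and "\<And>C. C \<in> \<F> \<Longrightarrow> max_T_convex T C"
    and "\<And>\<G>. \<G> \<subseteq> \<F> \<Longrightarrow> card \<G> \<le> CARD('d) + 1 \<Longrightarrow> \<Inter>\<G> \<noteq> {}"
  shows "\<Inter>\<F> \<noteq> {}"
  using assms(2-)
proof (induction \<F> rule: finite_psubset_induct)
  case (psubset \<F>)
  show ?case
  proof (cases "card \<F> \<le> CARD('d) + 1")
    case True
    then show ?thesis using psubset.prems by blast
  next
    case False
    then have "card (UNIV :: 'd option option set) \<le> card \<F>" by (simp add: card_UNIV_option)
    \<comment> \<open>Colour the family surjectively with \<open>d + 2\<close> colours and intersect the colour classes.\<close>
    then obtain g :: "'d option option \<Rightarrow> (real ^ 'd) set" where g: "inj g" "range g \<subseteq> \<F>"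
      using card_le_inj[of "UNIV :: 'd option option set" \<F>] psubset.hyps by auto
    \<comment> \<open>\<open>inv\<close> gives sets outside the range of \<open>g\<close> some
      arbitrary colour, so the whole family is coloured, and \<open>g i\<close> keeps class
      \<open>i\<close> nonempty.\<close>
    define c where "c = inv g"
    define A where "A i = \<Inter>{C \<in> \<F>. c C = i}" for i
    have c: "c (g i) = i" for i using g by (simp add: c_def)
    have "(\<Inter>i. A i) \<noteq> {}"
    proof (rule max_T_helly_indexed[OF T])
      show "CARD('d) + 2 \<le> CARD('d option option)" by (simp add: card_UNIV_option)
      show "max_T_convex T (A i)" for i
        unfolding A_def using g c psubset.prems by (intro max_T_convex_Inter) auto
      fix j
      \<comment> \<open>Class \<open>j\<close> contains \<open>g j\<close>, so omitting it leaves a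
        strictly smaller family.\<close>
      have "{C \<in> \<F>. c C \<noteq> j} \<subset> \<F>" using g(2) c[of j] by blast
      then have "\<Inter>{C \<in> \<F>. c C \<noteq> j} \<noteq> {}"
      proof (rule psubset.IH)
        show "max_T_convex T C" if "C \<in> {C \<in> \<F>. c C \<noteq> j}" for C
          using that psubset.prems(1) by blast
        show "\<Inter>\<G> \<noteq> {}" if "\<G> \<subseteq> {C \<in> \<F>. c C \<noteq> j}" "card \<G> \<le> CARD('d) + 1" for \<G>
          by (rule psubset.prems(2)) (use that in auto)
      qed
      then show "(\<Inter>i\<in>UNIV - {j}. A i) \<noteq> {}" unfolding A_def by blast
    qed
    then show ?thesis unfolding A_def by blast
  qed
qed

section \<open>The centerpoint theorem\<close>

text \<open>Each set misses less than a fraction \<open>1 / (d + 1)\<close> of the elements, so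
  \<open>d + 1\<close> sets together cannot miss all of them.\<close>

lemma exists_common_member_by_counting:
  fixes P :: "'a multiset"
  assumes "finite \<Q>" "card \<Q> \<le> d + 1"
    and "\<And>Q. Q \<in> \<Q> \<Longrightarrow> real (size (filter_mset (\<lambda>x. x \<in> Q) P)) > real d * real (size P) / (real d + 1)"
    and "P \<noteq> {#}"
  shows "\<exists>x\<in>#P. \<forall>Q\<in>\<Q>. x \<in> Q"
proof (cases "\<Q> = {}")
  \<comment> \<open>The strict comparison of sums in the other case needs a nonempty index
    set.\<close>
  case True
  then show ?thesis using assms(4) by auto
next
  case False
  show ?thesis
  proof (rule ccontr)
    assume neg: "\<not> ?thesis"
    have union: "size P \<le> (\<Sum>Q\<in>\<Q>. size (filter_mset (\<lambda>x. x \<notin> Q) P))"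
      using neg
    proof (induction P)
      case (add x P)
      then obtain Q where Q: "Q \<in> \<Q>" "x \<notin> Q" by auto
      have "size P + 1 \<le> (\<Sum>Q\<in>\<Q>. size (filter_mset (\<lambda>x. x \<notin> Q) P)) + (\<Sum>Q\<in>\<Q>. of_bool (x \<notin> Q))"
        using add Q member_le_sum[of Q \<Q> "\<lambda>Q. of_bool (x \<notin> Q) :: nat"] assms(1)
        by (intro add_mono) auto
      also have "\<dots> = (\<Sum>Q\<in>\<Q>. size (filter_mset (\<lambda>y. y \<notin> Q) (add_mset x P)))"
        unfolding sum.distrib[symmetric] by (intro sum.cong) auto
      finally show ?case by simp
    qed simp
    have small: "real (size (filter_mset (\<lambda>x. x \<notin> Q) P)) < real (size P) / (real d + 1)" if "Q \<in> \<Q>" for Q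
    proof -
      have "size P = size (filter_mset (\<lambda>x. x \<in> Q) P) + size (filter_mset (\<lambda>x. x \<notin> Q) P)"
        by (metis multiset_partition size_union)
      moreover have "real (size P) = (real d + 1) * real (size P) / (real d + 1)" by simp
      then have "real (size P) = real d * real (size P) / (real d + 1) + real (size P) / (real d + 1)"
        by (simp only: distrib_right add_divide_distrib mult_1)
      ultimately show ?thesis using assms(3)[OF that] by linarith
    qed
    have "real (size P) \<le> (\<Sum>Q\<in>\<Q>. real (size (filter_mset (\<lambda>x. x \<notin> Q) P)))"
      using union by (metis of_nat_mono of_nat_sum)
    also have "\<dots> < (\<Sum>Q\<in>\<Q>. real (size P) / (real d + 1))"
      using small assms(1) False by (intro sum_strict_mono) auto
    also have "\<dots> = real (card \<Q>) * (real (size P) / (real d + 1))" by simp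
    also have "\<dots> \<le> (real d + 1) * (real (size P) / (real d + 1))"
      using assms(2) by (intro mult_right_mono) auto
    also have "\<dots> = real (size P)" by simp
    finally show False by simp
  qed
qed

theorem theorem15:
  fixes T :: "real \<Rightarrow> real \<Rightarrow> real"
    and P :: "(real ^ 'd) multiset"
    and n :: nat
  assumes "continuous_t_norm T"
    and "set_mset P \<subseteq> unit_cube"
    and "size P = n"
  shows "\<exists>p\<in>unit_cube. \<forall>C. max_T_convex T C \<longrightarrow>
           real (size (filter_mset (\<lambda>x. x \<in> C) P)) > real CARD('d) * real n / (real CARD('d) + 1) \<longrightarrow>
           p \<in> C"
proof -
  define large where
    "large C \<longleftrightarrow> real (size (filter_mset (\<lambda>x. x \<in> C) P)) > real CARD('d) * real n / (real CARD('d) + 1)"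
    for C
  \<comment> \<open>The max-T convex hull; for \<open>Q\<close> inside the cube, the cube is one of
    the intersected sets.\<close>
  define cl where "cl Q = \<Inter>{C. max_T_convex T C \<and> Q \<subseteq> C}" for Q :: "(real ^ 'd) set"
  \<comment> \<open>Replacing each convex set by the hull of its points in \<open>P\<close> leaves a finite family; adding the
     cube keeps the common point in the cube.\<close>
  define \<F> where "\<F> = insert unit_cube (cl ` {Q. Q \<subseteq> set_mset P \<and> large Q})"
  have cube: "max_T_convex T unit_cube"
    using assms(1) unfolding continuous_t_norm_def t_norm_def max_T_convex_def
    by (auto simp: unit_cube_def vmax_def t_scale_def max_def)
  have cl: "max_T_convex T (cl Q)" if "Q \<subseteq> unit_cube" for Q
    unfolding cl_def using that cube by (intro max_T_convex_Inter) auto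
  have "\<Inter>\<F> \<noteq> {}"
  proof (rule max_T_helly[OF assms(1)])
    show "finite \<F>" unfolding \<F>_def by simp
    show "max_T_convex T C" if "C \<in> \<F>" for C
      using that cube cl assms(2) unfolding \<F>_def by auto
    fix \<G> assume \<G>: "\<G> \<subseteq> \<F>" "card \<G> \<le> CARD('d) + 1"
    have "finite \<G>" using \<G> \<open>finite \<F>\<close> finite_subset by blast
    show "\<Inter>\<G> \<noteq> {}"
    \<comment> \<open>For empty \<open>P\<close> the threshold is 0 and no set exceeds it, so only
      the cube remains in the family.\<close>
    proof (cases "P = {#}")
      case True
      then have "\<F> = {unit_cube}" using assms(3) by (simp add: \<F>_def large_def)
      moreover have "0 \<in> (unit_cube :: (real ^ 'd) set)" by (simp add: unit_cube_def)
      ultimately show ?thesis using \<G>(1) by blast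
    next
      case False
      \<comment> \<open>Every member of \<open>\<G>\<close> is large: the cube contains all of
        \<open>P\<close>, and a hull contains the large set generating it.\<close>
      have "\<exists>x\<in>#P. \<forall>C\<in>\<G>. x \<in> C"
      proof (rule exists_common_member_by_counting[OF \<open>finite \<G>\<close> \<G>(2) _ False])
        fix C assume "C \<in> \<G>"
        with \<G> consider "C = unit_cube" | Q where "C = cl Q" "Q \<subseteq> set_mset P" "large Q"
          unfolding \<F>_def by blast
        then have "large C"
        proof cases
          case 1
          then have "filter_mset (\<lambda>x. x \<in> C) P = P"
            using assms(2) by (auto simp: filter_mset_eq_conv)
          moreover have "n > 0" using assms(3) False by (simp add: nonempty_has_size)
          ultimately show ?thesis using assms(3) by (simp add: large_def field_simps)
        next
          case (2 Q)
          have "Q \<subseteq> C" unfolding 2 cl_def by blast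
          then have "size (filter_mset (\<lambda>x. x \<in> Q) P) \<le> size (filter_mset (\<lambda>x. x \<in> C) P)"
            by (intro size_mset_mono filter_mset_mono_strong) auto
          then show ?thesis using 2(3) unfolding large_def by linarith
        qed
        then show "real CARD('d) * real (size P) / (real CARD('d) + 1) < real (size {#x \<in># P. x \<in> C#})"
          unfolding large_def assms(3) .
      qed
      then show ?thesis by blast
    qed
  qed
  then obtain p where p: "p \<in> \<Inter>\<F>" by blast
  show ?thesis
  proof (intro bexI allI impI)
    show "p \<in> unit_cube" using p unfolding \<F>_def by blast
    fix C assume C: "max_T_convex T C"
      and *: "real (size (filter_mset (\<lambda>x. x \<in> C) P)) > real CARD('d) * real n / (real CARD('d) + 1)"
    \<comment> \<open>Only points of \<open>P\<close> are counted, so cutting \<open>C\<close> down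
      to them keeps it large, and the hull of what remains stays inside \<open>C\<close>.\<close>
    have "{#x \<in># P. x \<in> C \<inter> set_mset P#} = {#x \<in># P. x \<in> C#}"
      by (rule filter_mset_cong) auto
    with * have "large (C \<inter> set_mset P)" by (simp add: large_def)
    then have "cl (C \<inter> set_mset P) \<in> \<F>" unfolding \<F>_def by (intro insertI2 imageI) simp
    then have "p \<in> cl (C \<inter> set_mset P)" using p by (rule InterD[rotated])
    moreover have "cl (C \<inter> set_mset P) \<subseteq> C" unfolding cl_def using C by (intro Inter_lower) simp
    ultimately show "p \<in> C" by blast
  qed
qed

end
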